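(* Let $0<\lambda<1$ and let the update frequency satisfy $\delta\ge\lambda/(1-\lambda)$. Then the fixed point $y^*$ of the asynchronous fluid limit with parameters $(\lambda,\delta)$ satisfies $y^*_{i,j}=0$ for all $j\ge 2$ and $0\le i\le j$ (so that no server has more than one job at fluid level in the fixed point, i.e. queueing vanishes).
   Context: A state is an array $y=(y_{i,j})_{0\le i\le j}$ of nonnegative reals with $\sum_{0\le i\le j}y_{i,j}=1$; $y_{i,j}$ is the fraction of servers with queue length $i$ and queue estimate $j$. For a state $y$ put $v_i=\sum_{l\ge i}y_{i,l}$, $w_j=\sum_{k=0}^{j}y_{k,j}$, $m=\min\{j:w_j>0\}$, and $u_k=\delta\sum_{i=0}^{k-1}(k-i)v_i$. Let $n=m$ if $u_m\le\lambda$, and otherwise let $n=\max\{k:u_k\le\lambda\}\le m-1$. Put $\zeta=\lambda-u_n\ge 0$ and $q_{i,j}=\frac{y_{i,j}}{w_j}\mathbf 1\{n=j\}$ (interpreted as $0$ if $w_j=0$). The asynchronous fluid limit (exponential update intervals with rate $\delta$, arrival rate $\lambda$ per server) is governed by the system, for all $0\le i\le j$ with $j\ge n(t)$, $$\frac{dy_{i,j}(t)}{dt}=y_{i+1,j}\mathbf 1\{i<j\}-y_{i,j}\mathbf 1\{i>0\}+\zeta q_{i-1,j-1}\mathbf 1\{i>0\}-\zeta q_{i,j}+\delta\sum_{k=0}^{n-1}v_k\,\mathbf 1\{i=j=n\}+\delta v_i\mathbf 1\{i=j\ge n\}-\delta y_{i,j},$$ where all quantities on the right are evaluated at time $t$.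 A fixed point is a state $y$ for which the right-hand side vanishes for all $0\le i\le j$ with $j\ge n$. *)

theory Defs
  imports "HOL-Analysis.Analysis"
begin

(* A triangular array (y_{i,j})_{0 <= i <= j} is a function y on pairs of naturals: y i j is the
   fraction of servers with queue length i and queue estimate j.  Entries with i > j carry no
   meaning; they are left unconstrained and none of the definitions below depends on them. *)

definition is_state :: "(nat \<Rightarrow> nat \<Rightarrow> real) \<Rightarrow> bool" where
  "is_state y \<longleftrightarrow> (\<forall>i j. i \<le> j \<longrightarrow> 0 \<le> y i j) \<and> ((\<lambda>(i, j). y i j) has_sum 1) {(i, j). i \<le> j}"

definition queue_frac :: "(nat \<Rightarrow> nat \<Rightarrow> real) \<Rightarrow> nat \<Rightarrow> real" where
  "queue_frac y i = (\<Sum>\<^sub>\<infinity>l\<in>{i..}. y i l)"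

definition estimate_frac :: "(nat \<Rightarrow> nat \<Rightarrow> real) \<Rightarrow> nat \<Rightarrow> real" where
  "estimate_frac y j = (\<Sum>k\<le>j. y k j)"

(* The set is nonempty for every state, since the entries of y sum to 1. *)
definition min_estimate :: "(nat \<Rightarrow> nat \<Rightarrow> real) \<Rightarrow> nat" where
  "min_estimate y = (LEAST j. estimate_frac y j > 0)"

definition fill_rate :: "real \<Rightarrow> (nat \<Rightarrow> nat \<Rightarrow> real) \<Rightarrow> nat \<Rightarrow> real" where
  "fill_rate \<delta> y k = \<delta> * (\<Sum>i<k. real (k - i) * queue_frac y i)"

(* For a state, fill_rate is nonnegative and nondecreasing in k when 0 <= \<delta>, with value 0 at
   k = 0.  Hence, for 0 <= lam, the Max is over a nonempty subset of {..<min_estimate y}. *)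
definition target_level :: "real \<Rightarrow> real \<Rightarrow> (nat \<Rightarrow> nat \<Rightarrow> real) \<Rightarrow> nat" where
  "target_level lam \<delta> y =
     (if fill_rate \<delta> y (min_estimate y) \<le> lam then min_estimate y
      else Max {k. fill_rate \<delta> y k \<le> lam})"

definition excess_rate :: "real \<Rightarrow> real \<Rightarrow> (nat \<Rightarrow> nat \<Rightarrow> real) \<Rightarrow> real" where
  "excess_rate lam \<delta> y = lam - fill_rate \<delta> y (target_level lam \<delta> y)"

(* The convention that this is 0 when estimate_frac y j = 0 is that of division by zero in HOL. *)
definition assign_frac :: "real \<Rightarrow> real \<Rightarrow> (nat \<Rightarrow> nat \<Rightarrow> real) \<Rightarrow> nat \<Rightarrow> nat \<Rightarrow> real" where
  "assign_frac lam \<delta> y i j = y i j / estimate_frac y j * of_bool (target_level lam \<delta> y = j)"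

(* Right-hand side of the equation for the time derivative of y_{i,j}, for i <= j.  The truncated
   differences i - 1 and j - 1 occur only under the indicator of 0 < i, where 0 < j as well. *)
definition drift :: "real \<Rightarrow> real \<Rightarrow> (nat \<Rightarrow> nat \<Rightarrow> real) \<Rightarrow> nat \<Rightarrow> nat \<Rightarrow> real" where
  "drift lam \<delta> y i j =
     (let n = target_level lam \<delta> y; \<zeta> = excess_rate lam \<delta> y in
        y (i + 1) j * of_bool (i < j) - y i j * of_bool (0 < i)
      + \<zeta> * assign_frac lam \<delta> y (i - 1) (j - 1) * of_bool (0 < i) - \<zeta> * assign_frac lam \<delta> y i j
      + \<delta> * (\<Sum>k<n. queue_frac y k) * of_bool (i = j \<and> j = n)
      + \<delta> * queue_frac y i * of_bool (i = j \<and> n \<le> j) - \<delta> * y i j)"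

definition is_fixed_point :: "real \<Rightarrow> real \<Rightarrow> (nat \<Rightarrow> nat \<Rightarrow> real) \<Rightarrow> bool" where
  "is_fixed_point lam \<delta> y \<longleftrightarrow>
     is_state y \<and> (\<forall>i j. i \<le> j \<and> target_level lam \<delta> y \<le> j \<longrightarrow> drift lam \<delta> y i j = 0)"

end

(* If no server had an estimate equal to the target level n, the balance at (n, n) would force
   fill_rate to vanish at n + 1, against the maximality of n; so n is the minimal estimate.
   For j >= n + 2 the balance equations make queue_frac y j independent of j and equal to the mass
   of column j; these masses are summable, so only the columns n and n + 1 are nonzero.
   Summing i times the drift over these two columns gives the throughput identity v_0 = 1 - lam.
   Then n (1 - lam) delta <= fill_rate n <= lam <= (1 - lam) delta, so n <= 1; and n = 1 forces a
   vanishing excess rate, hence an empty column 2. *)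

theory Submission
  imports Defs
begin

section \<open>Column sums of the drift against a weight\<close>

lemma sum_atMost_pos_shift:
  fixes f :: "nat \<Rightarrow> real"
  shows "(\<Sum>i\<le>j. f i * of_bool (0 < i)) = (\<Sum>i<j. f (Suc i))"
  by (subst sum.atMost_shift) simp

lemma sum_atMost_strict:
  fixes f :: "nat \<Rightarrow> real"
  shows "(\<Sum>i\<le>j. f i * of_bool (i < j)) = (\<Sum>i<j. f i)"
  by (simp flip: lessThan_Suc_atMost)

text \<open>Summation by parts in each column: service lowers \<open>i\<close> by one, so it
  contributes differences of \<open>g\<close>. The weight 1 counts the servers of a column, the
  weight \<open>real\<close> counts their jobs.\<close>

lemma weighted_drift_sum:
  fixes lam \<delta> :: real and y :: "nat \<Rightarrow> nat \<Rightarrow> real" and g :: "nat \<Rightarrow> real"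
  defines "n \<equiv> target_level lam \<delta> y"
  shows "(\<Sum>i\<le>j. g i * drift lam \<delta> y i j) =
      (\<Sum>i<j. (g i - g (Suc i)) * y (Suc i) j)
    + excess_rate lam \<delta> y * ((\<Sum>i<j. g (Suc i) * assign_frac lam \<delta> y i (j - 1))
        - (\<Sum>i\<le>j. g i * assign_frac lam \<delta> y i j))
    + \<delta> * (g j * ((\<Sum>k<n. queue_frac y k) * of_bool (j = n) + queue_frac y j * of_bool (n \<le> j))
        - (\<Sum>i\<le>j. g i * y i j))"
proof -
  let ?z = "excess_rate lam \<delta> y" and ?q = "assign_frac lam \<delta> y"
  let ?c = "(\<Sum>k<n. queue_frac y k) * of_bool (j = n) + queue_frac y j * of_bool (n \<le> j)"
  have "g i * drift lam \<delta> y i j =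
      (g i * y (Suc i) j) * of_bool (i < j) - (g i * y i j) * of_bool (0 < i)
      + ?z * ((g i * ?q (i - 1) (j - 1)) * of_bool (0 < i)) - ?z * (g i * ?q i j)
      + (if i = j then \<delta> * (g j * ?c) else 0) - \<delta> * (g i * y i j)" for i
    by (auto simp: drift_def Let_def n_def algebra_simps)
  then have "(\<Sum>i\<le>j. g i * drift lam \<delta> y i j) =
      (\<Sum>i\<le>j. (g i * y (Suc i) j) * of_bool (i < j)) - (\<Sum>i\<le>j. (g i * y i j) * of_bool (0 < i))
      + ?z * (\<Sum>i\<le>j. (g i * ?q (i - 1) (j - 1)) * of_bool (0 < i)) - ?z * (\<Sum>i\<le>j. g i * ?q i j)
      + \<delta> * (g j * ?c) - \<delta> * (\<Sum>i\<le>j. g i * y i j)"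
    by (simp only: sum.distrib sum_subtractf sum_distrib_left) simp
  then show ?thesis
    by (simp only: sum_atMost_pos_shift sum_atMost_strict)
      (simp add: algebra_simps sum_subtractf sum.distrib)
qed

locale fluid_fixed_point =
  fixes lam \<delta> :: real and y :: "nat \<Rightarrow> nat \<Rightarrow> real"
  assumes lam_pos: "0 < lam" and \<delta>_pos: "0 < \<delta>" and fixed: "is_fixed_point lam \<delta> y"
begin

abbreviation v where "v \<equiv> queue_frac y"
abbreviation w where "w \<equiv> estimate_frac y"
abbreviation u where "u \<equiv> fill_rate \<delta> y"
abbreviation n where "n \<equiv> target_level lam \<delta> y"
abbreviation \<zeta> where "\<zeta> \<equiv> excess_rate lam \<delta> y"
abbreviation q where "q \<equiv> assign_frac lam \<delta> y"

section \<open>Rows and columns of a state\<close>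

lemma nonneg: "i \<le> j \<Longrightarrow> 0 \<le> y i j"
  using fixed by (auto simp: is_fixed_point_def is_state_def)

lemma total: "((\<lambda>(i, j). y i j) has_sum 1) {(i, j). i \<le> j}"
  using fixed by (auto simp: is_fixed_point_def is_state_def)

lemma balance: "i \<le> j \<Longrightarrow> n \<le> j \<Longrightarrow> drift lam \<delta> y i j = 0"
  using fixed by (auto simp: is_fixed_point_def)

lemma w_nonneg: "0 \<le> w j"
  by (auto simp: estimate_frac_def intro!: sum_nonneg nonneg)

lemma w_zero_iff: "w j = 0 \<longleftrightarrow> (\<forall>i\<le>j. y i j = 0)"
  unfolding estimate_frac_def by (subst sum_nonneg_eq_0_iff) (auto intro: nonneg)

lemma row_summable: "i \<le> k \<Longrightarrow> y i summable_on {k..}"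
proof -
  assume "i \<le> k"
  have "(\<lambda>(i, j). y i j) summable_on Pair i ` {k..}"
    by (rule summable_on_subset_banach[OF has_sum_imp_summable[OF total]]) (use \<open>i \<le> k\<close> in auto)
  then show ?thesis
    by (subst (asm) summable_on_reindex) (auto simp: inj_on_def o_def)
qed

lemma v_nonneg: "0 \<le> v i"
  by (auto simp: queue_frac_def intro!: infsum_nonneg nonneg)

lemma v_split: "v i = y i i + (\<Sum>\<^sub>\<infinity>l\<in>{Suc i..}. y i l)"
proof -
  have "{i..} = insert i {Suc i..}" by auto
  then show ?thesis
    unfolding queue_frac_def using row_summable[of i "Suc i"] by (simp add: infsum_insert)
qed

lemma sum_columns: "finite F \<Longrightarrow> (\<Sum>j\<in>F. w j) = (\<Sum>(i, j)\<in>{(i, j). i \<le> j \<and> j \<in> F}. y i j)"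
proof -
  assume "finite F"
  have "(\<Sum>j\<in>F. w j) = (\<Sum>(j, i)\<in>(SIGMA j:F. {..j}). y i j)"
    unfolding estimate_frac_def by (rule sum.Sigma) (use \<open>finite F\<close> in auto)
  also have "\<dots> = (\<Sum>(i, j)\<in>{(i, j). i \<le> j \<and> j \<in> F}. y i j)"
    by (rule sum.reindex_bij_witness[of _ prod.swap prod.swap]) auto
  finally show ?thesis .
qed

lemma finite_columns: "finite F \<Longrightarrow> finite {(i::nat, j). i \<le> j \<and> j \<in> F}"
  by (rule finite_subset[of _ "(\<Union>j\<in>F. {..j}) \<times> F"]) auto

lemma sum_columns_le_1: "finite F \<Longrightarrow> (\<Sum>j\<in>F. w j) \<le> 1"
  unfolding sum_columns
  by (rule finite_sum_le_has_sum[OF total finite_columns]) (auto intro: nonneg)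

lemma sum_columns_eq_1:
  assumes "finite F" and "\<And>j. j \<notin> F \<Longrightarrow> w j = 0"
  shows "(\<Sum>j\<in>F. w j) = 1"
proof -
  have "((\<lambda>(i, j). y i j) has_sum 1) {(i, j). i \<le> j \<and> j \<in> F}"
    using total
    by (rule has_sum_cong_neutral[THEN iffD1, rotated -1])
      (use assms(2) in \<open>auto simp: w_zero_iff\<close>)
  then have "(\<Sum>(i, j)\<in>{(i, j). i \<le> j \<and> j \<in> F}. y i j) = 1"
    using has_sum_unique has_sum_finite[OF finite_columns[OF assms(1)]] by blast
  then show ?thesis using sum_columns[OF assms(1)] by simp
qed

section \<open>The target level as the minimal estimate\<close>

lemma w_min_estimate_pos: "0 < w (min_estimate y)"
proof -
  have "\<exists>j. 0 < w j"
  proof (rule ccontr)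
    assume "\<not> ?thesis"
    then have "w j = 0" for j using w_nonneg[of j] by (auto simp: not_less intro: antisym)
    \<comment> \<open>With all columns empty, the empty set of columns would carry the total mass
      1.\<close>
    then show False using sum_columns_eq_1[of "{}"] by simp
  qed
  then show ?thesis unfolding min_estimate_def by (rule LeastI_ex)
qed

lemma w_below_min_estimate: "j < min_estimate y \<Longrightarrow> w j = 0"
  unfolding min_estimate_def using not_less_Least[of j] w_nonneg[of j] by fastforce

lemma u_mono: "mono u"
  unfolding incseq_Suc_iff
proof
  fix k
  have "(\<Sum>i<k. real (k - i) * v i) \<le> (\<Sum>i<k. real (Suc k - i) * v i)"
    by (intro sum_mono mult_right_mono v_nonneg) auto
  also have "\<dots> \<le> (\<Sum>i<Suc k. real (Suc k - i) * v i)"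
    using v_nonneg by simp
  finally show "u k \<le> u (Suc k)"
    unfolding fill_rate_def using \<delta>_pos by simp
qed

text \<open>Monotonicity of \<open>u\<close> bounds the set under \<open>Max\<close> by
  \<open>min_estimate y\<close>, and \<open>u 0 = 0\<close> puts 0 in it, so \<open>Max\<close> is a
  genuine maximum.\<close>

lemma target_level_maximal:
  assumes "lam < u (min_estimate y)"
  shows "n < min_estimate y" and "u n \<le> lam" and "lam < u (Suc n)"
proof -
  let ?S = "{k. u k \<le> lam}"
  have n_eq: "n = Max ?S"
    using assms by (simp add: target_level_def)
  have bound: "k < min_estimate y" if "u k \<le> lam" for k
  proof (rule ccontr)
    assume "\<not> k < min_estimate y"
    then have "u (min_estimate y) \<le> u k" using u_mono by (simp add: monoD)
    then show False using that assms by simp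
  qed
  then have fin: "finite ?S" by (auto intro: finite_subset[of _ "{..<min_estimate y}"])
  have "0 \<in> ?S" using lam_pos by (simp add: fill_rate_def)
  then have "n \<in> ?S" unfolding n_eq using Max_in[OF fin] by blast
  then show "u n \<le> lam" and "n < min_estimate y" using bound by auto
  show "lam < u (Suc n)"
  proof (rule ccontr)
    assume "\<not> lam < u (Suc n)"
    then have "Suc n \<le> Max ?S" by (intro Max_ge[OF fin]) simp
    then show False using n_eq by simp
  qed
qed

lemma target_level_eq_min_estimate: "n = min_estimate y"
proof (rule ccontr)
  assume "n \<noteq> min_estimate y"
  then have gt: "lam < u (min_estimate y)"
    by (auto simp: target_level_def split: if_splits)
  then have "w n = 0" using target_level_maximal(1) w_below_min_estimate by blast
  then have "y n n = 0" and "q n n = 0" by (auto simp: w_zero_iff assign_frac_def)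
  \<comment> \<open>For \<open>n = 0\<close> the truncated index is \<open>n\<close> itself and the
    indicator vanishes; for \<open>n > 0\<close> column \<open>n - 1\<close> is off target.\<close>
  moreover have "q (n - 1) (n - 1) * of_bool (0 < n) = 0"
    by (cases "n = 0") (auto simp: assign_frac_def)
  ultimately have "\<delta> * ((\<Sum>k<n. v k) + v n) = 0"
    using balance[of n n] by (auto simp: drift_def Let_def distrib_left mult.assoc)
  then have "(\<Sum>k<n. v k) + v n = 0" using \<delta>_pos by simp
  then have "(\<Sum>k<Suc n. v k) = 0" by simp
  then have "\<forall>k<Suc n. v k = 0"
    by (subst (asm) sum_nonneg_eq_0_iff) (auto intro: v_nonneg)
  then have "u (Suc n) = 0" by (simp add: fill_rate_def)
  then show False using target_level_maximal(3)[OF gt] lam_pos by simp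
qed

lemma w_target_pos: "0 < w n"
  using w_min_estimate_pos target_level_eq_min_estimate by simp

lemma w_below_target: "j < n \<Longrightarrow> w j = 0"
  using w_below_min_estimate target_level_eq_min_estimate by simp

lemma u_target_le: "u n \<le> lam"
  using target_level_maximal(2) target_level_eq_min_estimate by fastforce

lemma excess_rate_eq: "\<zeta> = lam - u n"
  by (simp add: excess_rate_def)

section \<open>Column balances and emptiness beyond \<open>n + 1\<close>\<close>

lemma q_off_target: "j \<noteq> n \<Longrightarrow> q i j = 0"
  by (simp add: assign_frac_def)

lemma sum_q_target: "(\<Sum>i\<le>n. q i n) = 1"
  using w_target_pos by (simp add: assign_frac_def estimate_frac_def flip: sum_divide_distrib)

lemma weighted_balance:
  assumes "n \<le> j"
  shows "(\<Sum>i<j. (g i - g (Suc i)) * y (Suc i) j)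
    + \<zeta> * ((\<Sum>i<j. g (Suc i) * q i (j - 1)) - (\<Sum>i\<le>j. g i * q i j))
    + \<delta> * (g j * ((\<Sum>k<n. v k) * of_bool (j = n) + v j) - (\<Sum>i\<le>j. g i * y i j)) = 0"
  using weighted_drift_sum[of g lam \<delta> y j] assms by (simp add: balance)

text \<open>With weight 1 service cancels. Assignments touch only the columns \<open>n\<close> and
  \<open>n + 1\<close>, so here the updates into column \<open>j\<close> balance those out of
  it.\<close>

lemma v_eq_w: "n + 2 \<le> j \<Longrightarrow> v j = w j"
  using weighted_balance[of j "\<lambda>_. 1"] \<delta>_pos by (simp add: q_off_target estimate_frac_def)

text \<open>Above the diagonal, row \<open>Suc j\<close> is \<open>1 + \<delta>\<close> times row
  \<open>j\<close>. The diagonal balance gives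
  \<open>(1 + \<delta>) * y j j = \<delta> * v j\<close>, which compensates exactly for that
  factor.\<close>

lemma v_Suc:
  assumes "n + 2 \<le> j"
  shows "v (Suc j) = v j"
proof -
  have "y (Suc j) l = (1 + \<delta>) * y j l" if "l \<in> {Suc j..}" for l
    using balance[of j l] assms that
    by (auto simp: drift_def Let_def q_off_target algebra_simps)
  then have "v (Suc j) = (\<Sum>\<^sub>\<infinity>l\<in>{Suc j..}. (1 + \<delta>) * y j l)"
    unfolding queue_frac_def by (rule infsum_cong)
  also have "\<dots> = (1 + \<delta>) * (\<Sum>\<^sub>\<infinity>l\<in>{Suc j..}. y j l)"
    using row_summable[of j "Suc j"] by (simp add: infsum_cmult_right)
  also have "\<dots> = (1 + \<delta>) * (v j - y j j)"
    by (simp add: v_split[of j])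
  also have "\<dots> = v j"
    using balance[of j j] assms
    by (auto simp: drift_def Let_def q_off_target algebra_simps)
  finally show ?thesis .
qed

lemma w_above_target:
  assumes "n + 2 \<le> j"
  shows "w j = 0"
proof (rule ccontr)
  assume "w j \<noteq> 0"
  then have pos: "0 < w j" using w_nonneg[of j] by simp
  have const: "w (j + k) = w j" for k
    by (induction k) (use assms v_Suc v_eq_w in auto)
  \<comment> \<open>So many columns of equal mass exceed the total mass 1.\<close>
  obtain N where N: "1 < real N * w j"
    using ex_less_of_nat_mult[OF pos] by blast
  have "(\<Sum>i\<in>(+) j ` {..<N}. w i) = real N * w j"
    by (subst sum.reindex) (auto simp: const)
  then show False using N sum_columns_le_1[of "(+) j ` {..<N}"] by simp
qed

lemma w_off_target: "j \<noteq> n \<Longrightarrow> j \<noteq> Suc n \<Longrightarrow> w j = 0"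
  using w_below_target[of j] w_above_target[of j] by linarith

lemma v_le_target:
  assumes "i \<le> n"
  shows "v i = y i n + y i (Suc n)"
proof -
  have "v i = (\<Sum>\<^sub>\<infinity>l\<in>{n, Suc n}. y i l)"
    unfolding queue_frac_def
    by (rule infsum_cong_neutral) (use assms w_off_target in \<open>auto simp: w_zero_iff\<close>)
  then show ?thesis by simp
qed

text \<open>Row \<open>Suc n\<close> starts at its diagonal entry, so it does not meet column
  \<open>n\<close>.\<close>

lemma v_Suc_target: "v (Suc n) = y (Suc n) (Suc n)"
proof -
  have "v (Suc n) = (\<Sum>\<^sub>\<infinity>l\<in>{Suc n}. y (Suc n) l)"
    unfolding queue_frac_def
    by (rule infsum_cong_neutral) (use w_off_target in \<open>auto simp: w_zero_iff\<close>)
  then show ?thesis by simp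
qed

section \<open>Job balance over the two occupied columns\<close>

lemma throughput: "v 0 = 1 - lam"
proof -
  have col_n: "- (\<Sum>i<n. y (Suc i) n) - \<zeta> * (\<Sum>i\<le>n. real i * q i n)
      + \<delta> * (real n * ((\<Sum>k<n. v k) + v n) - (\<Sum>i\<le>n. real i * y i n)) = 0"
  proof -
    \<comment> \<open>Nothing is assigned into column \<open>n\<close>. The condition
      \<open>i < n\<close> excludes \<open>n = 0\<close>, where \<open>n - 1\<close> would be
      \<open>n\<close>.\<close>
    have "q i (n - 1) = 0" if "i < n" for i using that by (simp add: q_off_target)
    then show ?thesis
      using weighted_balance[of n real] by (simp add: sum_negf)
  qed
  \<comment> \<open>An assignment moves a server from \<open>(i, n)\<close> to
    \<open>(i + 1, n + 1)\<close>; the \<open>+ 1\<close> is the job it brings.\<close>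
  have col_Suc: "- (\<Sum>i\<le>n. y (Suc i) (Suc n)) + \<zeta> * ((\<Sum>i\<le>n. real i * q i n) + 1)
      + \<delta> * (real (Suc n) * v (Suc n) - (\<Sum>i\<le>Suc n. real i * y i (Suc n))) = 0"
    using weighted_balance[of "Suc n" real] sum_q_target
    by (simp add: sum_negf q_off_target lessThan_Suc_atMost algebra_simps sum.distrib
        del: sum.lessThan_Suc sum.atMost_Suc)
  have "(\<Sum>j\<in>{n, Suc n}. w j) = 1"
    by (rule sum_columns_eq_1) (auto simp: w_off_target)
  \<comment> \<open>The left side is the total service rate, one per server with a nonempty
    queue.\<close>
  then have mass: "(\<Sum>i<n. y (Suc i) n) + (\<Sum>i\<le>n. y (Suc i) (Suc n)) = 1 - v 0"
    by (simp add: estimate_frac_def sum.atMost_shift v_le_target lessThan_Suc_atMost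
        del: sum.lessThan_Suc sum.atMost_Suc)
  have "(\<Sum>i\<le>n. real i * y i n) + (\<Sum>i\<le>Suc n. real i * y i (Suc n))
      = (\<Sum>i\<le>n. real i * v i) + real (Suc n) * v (Suc n)"
    by (simp add: v_le_target v_Suc_target algebra_simps sum.distrib)
  then have "\<delta> * (\<Sum>i\<le>n. real i * y i n) + \<delta> * (\<Sum>i\<le>Suc n. real i * y i (Suc n))
      = \<delta> * (\<Sum>i\<le>n. real i * v i) + \<delta> * (real (Suc n) * v (Suc n))"
    by (simp only: flip: distrib_left)
  \<comment> \<open>Updates fill each queue \<open>i < n\<close> up to \<open>n\<close>, adding
    \<open>n - i\<close> jobs; the term \<open>i = n\<close> is zero. At level \<open>n + 1\<close>
    updates leave the queue length unchanged and cancel.\<close>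
  moreover have "u n = \<delta> * (real n * ((\<Sum>k<n. v k) + v n) - (\<Sum>i\<le>n. real i * v i))"
    unfolding fill_rate_def lessThan_Suc_atMost[symmetric]
    by (simp add: algebra_simps sum_subtractf sum_distrib_left of_nat_diff)
  ultimately have "\<zeta> - (1 - v 0) + u n = 0"
    using col_n col_Suc mass
    unfolding distrib_left right_diff_distrib by linarith
  then show ?thesis using excess_rate_eq by simp
qed

section \<open>Bound on the target level and conclusion\<close>

text \<open>The idle servers alone, \<open>v 0\<close> of them, account for this part of
  \<open>u n\<close>.\<close>

lemma fill_rate_ge: "real n * (\<delta> * (1 - lam)) \<le> u n"
proof (cases "n = 0")
  case False
  have "real (n - 0) * v 0 \<le> (\<Sum>i<n. real (n - i) * v i)"
    by (rule member_le_sum) (use False v_nonneg in auto)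
  then have "\<delta> * (real n * (1 - lam)) \<le> u n"
    using \<delta>_pos unfolding fill_rate_def throughput by (intro mult_left_mono) auto
  then show ?thesis by (simp add: algebra_simps)
qed (simp add: fill_rate_def)

text \<open>Without excess arrivals, updates return to the diagonal entry exactly what they take
  from it, since it is all of \<open>v (Suc n)\<close>. Service then drains it to zero, and the mass
  balance empties the column.\<close>

lemma Suc_target_column_empty:
  assumes "\<zeta> = 0"
  shows "w (Suc n) = 0"
proof -
  have "v (Suc n) = w (Suc n)"
    using weighted_balance[of "Suc n" "\<lambda>_. 1"] \<delta>_pos assms by (simp add: estimate_frac_def)
  moreover have "y (Suc n) (Suc n) = 0"
    using balance[of "Suc n" "Suc n"] assms
    by (simp add: drift_def Let_def v_Suc_target)
  ultimately show ?thesis by (simp add: v_Suc_target)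
qed

lemma no_queueing:
  assumes "lam \<le> \<delta> * (1 - lam)" and "2 \<le> j"
  shows "w j = 0"
proof -
  have "real n * lam \<le> real n * (\<delta> * (1 - lam))"
    using assms(1) by (intro mult_left_mono) auto
  then have le: "real n * lam \<le> u n"
    using fill_rate_ge by linarith
  then have "real n * lam \<le> 1 * lam"
    using u_target_le by linarith
  then have "n \<le> 1"
    using lam_pos by (simp only: mult_le_cancel_right_pos)
  then consider "n = 0" | "n = 1" by linarith
  then show ?thesis
  proof cases
    case 1
    then show ?thesis using w_above_target assms(2) by simp
  next
    case 2
    \<comment> \<open>At \<open>n = 1\<close> the bounds
      \<open>real n * lam \<le> u n \<le> lam\<close> are tight.\<close>
    then have "\<zeta> = 0" using le u_target_le excess_rate_eq by simp
    then show ?thesis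
      using Suc_target_column_empty w_off_target[of j] assms(2) 2 by (cases "j = Suc n") auto
  qed
qed

end

theorem corollary5p2:
  fixes lam \<delta> :: real and y :: "nat \<Rightarrow> nat \<Rightarrow> real"
  assumes "0 < lam" and "lam < 1"
    and "\<delta> \<ge> lam / (1 - lam)"
    and "is_fixed_point lam \<delta> y"
  shows "\<forall>i j. 2 \<le> j \<and> i \<le> j \<longrightarrow> y i j = 0"
proof -
  have "0 < lam / (1 - lam)" using assms by simp
  then have "0 < \<delta>" using assms(3) by linarith
  then interpret fluid_fixed_point lam \<delta> y
    using assms by unfold_locales
  have "lam \<le> \<delta> * (1 - lam)"
    using assms by (simp add: pos_divide_le_eq)
  then show ?thesis
    using no_queueing w_zero_iff by blast
qed

end
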